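(* Let $A>0$. The metric $m$ on $\mathfrak{AT}_A$ is Finsler. More precisely, $m$ is the length metric associated with the Finsler structure $F$ on $\mathfrak{AT}_A$ given, at a point $a=(a_1,a_2,a_3)\in\mathfrak{AT}_A$ and a tangent vector $v=(v_1,v_2,v_3)\in T_a\mathfrak{AT}_A\subset\mathbb{R}^3$, by $$F(a,v)=\max_{i\in\{1,2,3\}}\frac{|v_i|}{a_i}.$$
   Context: $\mathfrak{AT}_A$ is the set of acute (all angles $<\pi/2$) labeled Euclidean triangles of area $A$ modulo label-respecting isometry, where a labeled triangle has its vertices labeled $v_1,v_2,v_3$ in counter-clockwise order. In the edge model, $\mathfrak{AT}_A$ is identified with the 2-dimensional submanifold of $(0,\infty)^3$ consisting of the triples $(a_1,a_2,a_3)$ that are the edge lengths ($a_i$ being the length of the edge opposite $v_i$) of an acute triangle of area $A$. Its tangent space at $a$ is viewed as a 2-dimensional linear subspace of $\mathbb{R}^3$. The metric is $$m(a,a')=\log\Big(\max\Big\{\tfrac{a_1}{a_1'},\tfrac{a_1'}{a_1},\tfrac{a_2}{a_2'},\tfrac{a_2'}{a_2},\tfrac{a_3}{a_3'},\tfrac{a_3'}{a_3}\Big\}\Big)=\max_i|\log a_i'-\log a_i|.$$ A weak norm on a real vector space $V$ is a function $V\to[0,\infty)$, $v\mapsto\|v\|$, such that for all $v,w\in V$: $\|v\|=0$ iff $v=0$; $\|tv\|=t\|v\|$ for $t>0$; and $\|tv+(1-t)w\|\le t\|v\|+(1-t)\|w\|$ for $t\in[0,1]$. A Finsler structure on a differentiable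 manifold $M$ is a continuous function $F:TM\to[0,\infty)$ whose restriction to each $T_xM$ is a weak norm. For a (piecewise) $C^1$ curve $c:[a,b]\to M$, $l_F(c)=\int_a^bF(\dot c(t))\,dt$. A metric $d$ on $M$ is Finsler, and is the length metric associated with the Finsler structure $F$, if for all $x,y\in M$, $d(x,y)=\inf\{l_F(c)\}$, with $c$ ranging over all piecewise $C^1$ curves $c:[0,1]\to M$ with $c(0)=x$, $c(1)=y$. *)

theory Defs
  imports "HOL-Analysis.Analysis"
begin

section \<open>Weak norms and Finsler structures\<close>

definition weak_norm_on :: "'a::real_vector set \<Rightarrow> ('a \<Rightarrow> real) \<Rightarrow> bool" where
  "weak_norm_on V N \<longleftrightarrow>
     subspace V \<and>
     (\<forall>v\<in>V. 0 \<le> N v) \<and>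
     (\<forall>v\<in>V. N v = 0 \<longleftrightarrow> v = 0) \<and>
     (\<forall>v\<in>V. \<forall>t>0. N (t *\<^sub>R v) = t * N v) \<and>
     (\<forall>v\<in>V. \<forall>w\<in>V. \<forall>t\<in>{0..1}. N (t *\<^sub>R v + (1 - t) *\<^sub>R w) \<le> t * N v + (1 - t) * N w)"

text \<open>
  Manifolds are submanifolds \<open>M\<close> of a Euclidean space.  The tangent space at a point of such a
  submanifold consists of the velocities of the \<open>C\<^sup>1\<close> curves in \<open>M\<close> through that point.
\<close>

definition tangent_space :: "'a::euclidean_space set \<Rightarrow> 'a \<Rightarrow> 'a set" where
  "tangent_space M x =
     {v. \<exists>c e. e > 0 \<and> c C1_differentiable_on {-e<..<e} \<and> c ` {-e<..<e} \<subseteq> M \<and>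
           c 0 = x \<and> (c has_vector_derivative v) (at 0)}"

definition tangent_bundle :: "'a::euclidean_space set \<Rightarrow> ('a \<times> 'a) set" where
  "tangent_bundle M = Sigma M (tangent_space M)"

definition finsler_structure :: "'a::euclidean_space set \<Rightarrow> ('a \<Rightarrow> 'a \<Rightarrow> real) \<Rightarrow> bool" where
  "finsler_structure M F \<longleftrightarrow>
     continuous_on (tangent_bundle M) (\<lambda>(x, v). F x v) \<and>
     (\<forall>x\<in>M. weak_norm_on (tangent_space M x) (F x))"

text \<open>
  The library's \<open>piecewise_C1_differentiable_on\<close> is too weak here: it does not control the
  derivative near a breakpoint, so that it admits curves of infinite length, to which
  \<open>integral\<close> may assign the value 0.  Below, each piece is \<open>C\<^sup>1\<close> up to and including its
  endpoints.
\<close>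

definition C1_curve :: "real \<Rightarrow> real \<Rightarrow> (real \<Rightarrow> 'a::real_normed_vector) \<Rightarrow> bool" where
  "C1_curve a b c \<longleftrightarrow>
     (\<exists>c'. continuous_on {a..b} c' \<and>
           (\<forall>t\<in>{a..b}. (c has_vector_derivative c' t) (at t within {a..b})))"

definition piecewise_C1_curve :: "real \<Rightarrow> real \<Rightarrow> (real \<Rightarrow> 'a::real_normed_vector) \<Rightarrow> bool" where
  "piecewise_C1_curve a b c \<longleftrightarrow>
     (\<exists>(n::nat) s. s 0 = a \<and> s n = b \<and>
        (\<forall>i<n. s i < s (Suc i) \<and> C1_curve (s i) (s (Suc i)) c))"

definition curves_between ::
    "'a::real_normed_vector set \<Rightarrow> 'a \<Rightarrow> 'a \<Rightarrow> (real \<Rightarrow> 'a) set" where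
  "curves_between M x y =
     {c. piecewise_C1_curve 0 1 c \<and> c ` {0..1} \<subseteq> M \<and> c 0 = x \<and> c 1 = y}"

text \<open>At the finitely many breakpoints the value of the integrand is irrelevant.\<close>

definition finsler_length ::
    "('a::real_normed_vector \<Rightarrow> 'a \<Rightarrow> real) \<Rightarrow> real \<Rightarrow> real \<Rightarrow> (real \<Rightarrow> 'a) \<Rightarrow> real" where
  "finsler_length F a b c =
     integral {a..b} (\<lambda>t. F (c t) (vector_derivative c (at t within {a..b})))"

text \<open>
  The locale \<open>Metric_space\<close> also constrains \<open>d\<close> outside \<open>M\<close>; the truncation removes this.
\<close>

definition metric_on :: "'a set \<Rightarrow> ('a \<Rightarrow> 'a \<Rightarrow> real) \<Rightarrow> bool" where
  "metric_on M d \<longleftrightarrow> Metric_space M (\<lambda>x y. if x \<in> M \<and> y \<in> M then d x y else 0)"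

text \<open>
  The infimum is taken in the extended reals, where the infimum of the empty set is \<open>\<infinity>\<close>; so the
  equation also asserts that some admissible curve joins \<open>x\<close> to \<open>y\<close>.
\<close>

definition length_metric_of ::
    "'a::euclidean_space set \<Rightarrow> ('a \<Rightarrow> 'a \<Rightarrow> real) \<Rightarrow> ('a \<Rightarrow> 'a \<Rightarrow> real) \<Rightarrow> bool" where
  "length_metric_of M F d \<longleftrightarrow>
     metric_on M d \<and> finsler_structure M F \<and>
     (\<forall>x\<in>M. \<forall>y\<in>M. ereal (d x y) = (INF c\<in>curves_between M x y. ereal (finsler_length F 0 1 c)))"

definition finsler_metric :: "'a::euclidean_space set \<Rightarrow> ('a \<Rightarrow> 'a \<Rightarrow> real) \<Rightarrow> bool" where
  "finsler_metric M d \<longleftrightarrow> (\<exists>F. length_metric_of M F d)"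

section \<open>Acute triangles of fixed area in the edge model\<close>

definition angle_at :: "real^2 \<Rightarrow> real^2 \<Rightarrow> real^2 \<Rightarrow> real" where
  "angle_at p q r = arccos (((q - p) \<bullet> (r - p)) / (norm (q - p) * norm (r - p)))"

definition ccw_triangle :: "real^2 \<Rightarrow> real^2 \<Rightarrow> real^2 \<Rightarrow> bool" where
  "ccw_triangle p q r \<longleftrightarrow> det (vector [q - p, r - p] :: real^2^2) > 0"

definition acute_triangle :: "real^2 \<Rightarrow> real^2 \<Rightarrow> real^2 \<Rightarrow> bool" where
  "acute_triangle p q r \<longleftrightarrow>
     angle_at p q r < pi/2 \<and> angle_at q r p < pi/2 \<and> angle_at r p q < pi/2"

definition edge_lengths :: "real^2 \<Rightarrow> real^2 \<Rightarrow> real^2 \<Rightarrow> real^3" where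
  "edge_lengths p q r = vector [dist q r, dist r p, dist p q]"

definition acute_triangles :: "real \<Rightarrow> (real^3) set" where
  "acute_triangles A =
     {edge_lengths p q r | p q r.
        ccw_triangle p q r \<and> acute_triangle p q r \<and> measure lborel (convex hull {p, q, r}) = A}"

definition m_dist :: "real^3 \<Rightarrow> real^3 \<Rightarrow> real" where
  "m_dist a a' = ln (Max {a$1 / a'$1, a'$1 / a$1, a$2 / a'$2, a'$2 / a$2, a$3 / a'$3, a'$3 / a$3})"

definition F_edge :: "real^3 \<Rightarrow> real^3 \<Rightarrow> real" where
  "F_edge a v = (MAX i\<in>{1, 2, 3}. \<bar>v$i\<bar> / a$i)"

end

theory Submission
  imports Defs
begin

text \<open>
  Let \<open>p\<^sub>i\<close> be the dot product of the two edge vectors at the vertex \<open>v\<^sub>i\<close> (Conway's triangle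
  notation).  Then \<open>a\<^sub>i\<^sup>2 = p\<^sub>j + p\<^sub>k\<close>, and the acute triangles of area \<open>A\<close> are the positive solutions
  of \<open>p\<^sub>1p\<^sub>2 + p\<^sub>2p\<^sub>3 + p\<^sub>3p\<^sub>1 = 4A\<^sup>2\<close>.  Along any curve, \<open>F\<close> dominates \<open>\<bar>(log a\<^sub>i)'\<bar>\<close>, so lengths are at
  least \<open>m\<close>.  Conversely, given two such \<open>p\<close> and \<open>q\<close>, two of the three differences \<open>q\<^sub>i - p\<^sub>i\<close>, say the
  \<open>j\<close>th and the \<open>k\<close>th, have the same weak sign.  Moving \<open>p\<^sub>j\<close> and \<open>p\<^sub>k\<close> linearly and solving for \<open>p\<^sub>i\<close>,
  one stays among acute triangles, \<open>a\<^sub>i\<close> is monotone, and \<open>\<bar>(log a\<^sub>l)'\<bar> \<le> \<bar>(log a\<^sub>i)'\<bar>\<close> for all \<open>l\<close>; so the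
  curve has length \<open>\<bar>log a\<^sub>i(q) - log a\<^sub>i(p)\<bar> \<le> m\<close>.
\<close>

section \<open>Conway parameters and edge lengths\<close>

text \<open>By the law of cosines the dot product at the \<open>i\<close>th vertex is half of
  \<open>a\<^sub>j\<^sup>2 + a\<^sub>k\<^sup>2 - a\<^sub>i\<^sup>2\<close>; the form here is
  symmetric in the indices.\<close>

definition conway_params :: "real^3 \<Rightarrow> real^3" where
  "conway_params a = (\<chi> i. (\<Sum>j\<in>UNIV. (a$j)\<^sup>2) / 2 - (a$i)\<^sup>2)"

definition conway_edges :: "real^3 \<Rightarrow> real^3" where
  "conway_edges p = (\<chi> i. sqrt ((\<Sum>j\<in>UNIV. p$j) - p$i))"

text \<open>The equation is Heron's formula in Conway parameters; positivity of the entries encodes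
  acuteness.\<close>

definition conway_set :: "real \<Rightarrow> (real^3) set" where
  "conway_set A = {p. (\<forall>i. 0 < p$i) \<and> p$1 * p$2 + p$2 * p$3 + p$3 * p$1 = (2 * A)\<^sup>2}"

text \<open>Lets later arguments run for an arbitrary ordering \<open>i\<close>, \<open>j\<close>,
  \<open>k\<close> of the indices, so that the connecting curve is constructed once.\<close>

lemma sum_distinct3:
  fixes f :: "3 \<Rightarrow> 'a::comm_monoid_add"
  assumes "i \<noteq> j" "j \<noteq> k" "i \<noteq> k"
  shows "(\<Sum>l\<in>UNIV. f l) = f i + f j + f k"
proof -
  have "(UNIV::3 set) = {i, j, k}"
    using assms exhaust_3[of i] exhaust_3[of j] exhaust_3[of k] unfolding UNIV_3 by auto
  then show ?thesis using assms by (simp only: \<open>UNIV = _\<close>) (simp add: add.assoc)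
qed

lemma exhaust_distinct3:
  fixes i j k l :: 3
  assumes "i \<noteq> j" "j \<noteq> k" "i \<noteq> k"
  shows "l = i \<or> l = j \<or> l = k"
  using assms exhaust_3[of i] exhaust_3[of j] exhaust_3[of k] exhaust_3[of l] by metis

lemma conway_set_distinct3:
  assumes "i \<noteq> j" "j \<noteq> k" "i \<noteq> k"
  shows "p \<in> conway_set A \<longleftrightarrow>
    0 < p$i \<and> 0 < p$j \<and> 0 < p$k \<and> p$i * p$j + p$j * p$k + p$k * p$i = (2 * A)\<^sup>2"
  using assms exhaust_3[of i] exhaust_3[of j] exhaust_3[of k]
  unfolding conway_set_def mem_Collect_eq forall_3 by (elim disjE) (auto simp: algebra_simps)

lemma conway_params_edges:
  assumes "p \<in> conway_set A"
  shows "conway_params (conway_edges p) = p"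
  using assms
  by (simp add: conway_params_def conway_edges_def conway_set_def vec_eq_iff forall_3 sum_3
      add_divide_distrib)

lemma conway_edges_pos: "p \<in> conway_set A \<Longrightarrow> 0 < conway_edges p $ i"
  using exhaust_3[of i] by (auto simp: conway_edges_def conway_set_def sum_3 forall_3)

lemma conway_edges_params:
  assumes "\<And>i. 0 < a$i"
  shows "conway_edges (conway_params a) = a"
  using assms less_imp_le[OF assms]
  by (simp add: conway_params_def conway_edges_def vec_eq_iff forall_3 sum_3 field_simps)

section \<open>Realization of Conway parameters by acute triangles\<close>

text \<open>\<open>arccos\<close> decreases strictly on [-1, 1], where Cauchy-Schwarz puts the
  quotient, and \<open>arccos 0\<close> is \<open>pi/2\<close>.\<close>

lemma angle_at_less_pi_half_iff:
  assumes "p \<noteq> q" "p \<noteq> r"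
  shows "angle_at p q r < pi/2 \<longleftrightarrow> 0 < (q - p) \<bullet> (r - p)"
proof -
  let ?c = "((q - p) \<bullet> (r - p)) / (norm (q - p) * norm (r - p))"
  have pos: "0 < norm (q - p) * norm (r - p)" using assms by simp
  have "\<bar>?c\<bar> \<le> 1"
    using Cauchy_Schwarz_ineq2[of "q - p" "r - p"] pos by (simp add: abs_mult)
  then have "arccos ?c < arccos 0 \<longleftrightarrow> 0 < ?c" by (intro arccos_less_mono) auto
  then show ?thesis using pos by (simp add: angle_at_def zero_less_divide_iff zero_less_mult_iff)
qed

lemma ccw_triangle_iff:
  "ccw_triangle p q r \<longleftrightarrow> 0 < (q$1 - p$1) * (r$2 - p$2) - (q$2 - p$2) * (r$1 - p$1)"
  by (simp add: ccw_triangle_def det_2)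

text \<open>The orientation resolves the absolute value in \<open>content_triangle\<close>.\<close>

lemma ccw_triangle_measure:
  assumes "ccw_triangle p q r"
  shows "measure lborel (convex hull {p, q, r}) =
    ((q$1 - p$1) * (r$2 - p$2) - (q$2 - p$2) * (r$1 - p$1)) / 2"
proof -
  have "measure lborel (convex hull {p, q, r}) = measure lebesgue (convex hull {p, q, r})"
    by (simp add: compact_imp_closed finite_imp_compact_convex_hull)
  with assms show ?thesis
    unfolding content_triangle ccw_triangle_iff by (simp add: algebra_simps)
qed

lemma acute_triangle_iff:
  assumes "ccw_triangle p q r"
  shows "acute_triangle p q r \<longleftrightarrow>
    0 < (q - p) \<bullet> (r - p) \<and> 0 < (r - q) \<bullet> (p - q) \<and> 0 < (p - r) \<bullet> (q - r)"
proof -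
  have "p \<noteq> q" "q \<noteq> r" "r \<noteq> p" using assms unfolding ccw_triangle_iff by auto
  then show ?thesis
    unfolding acute_triangle_def by (metis angle_at_less_pi_half_iff)
qed

text \<open>Each squared edge is the sum of the dot products at its two ends: in
  \<open>(r - q) \<bullet> (r - q)\<close>, split one factor as
  \<open>(p - q) + (r - p)\<close>.\<close>

lemma edge_lengths_conway:
  "edge_lengths p q r =
    conway_edges (vector [(q - p) \<bullet> (r - p), (r - q) \<bullet> (p - q), (p - r) \<bullet> (q - r)])"
  by (simp add: edge_lengths_def conway_edges_def vec_eq_iff forall_3 sum_3 dist_norm
      norm_eq_sqrt_inner inner_vec_def sum_2 algebra_simps)

lemma acute_triangles_eq_image:
  assumes "A > 0"
  shows "acute_triangles A = conway_edges ` conway_set A"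
proof (intro equalityI subsetI)
  fix a assume "a \<in> acute_triangles A"
  then obtain p q r where a: "a = edge_lengths p q r" and ccw: "ccw_triangle p q r"
    and acute: "acute_triangle p q r" and area: "measure lborel (convex hull {p, q, r}) = A"
    unfolding acute_triangles_def by blast
  let ?P = "vector [(q - p) \<bullet> (r - p), (r - q) \<bullet> (p - q), (p - r) \<bullet> (q - r)] :: real^3"
  have A: "2 * A = (q$1 - p$1) * (r$2 - p$2) - (q$2 - p$2) * (r$1 - p$1)"
    using ccw_triangle_measure[OF ccw] area by simp
  \<comment> \<open>With \<open>u = q - p\<close> and \<open>v = r - p\<close>, the quadratic form
    equals \<open>(u \<bullet> u) * (v \<bullet> v) - (u \<bullet> v)\<^sup>2\<close>, which is the
    squared determinant by Lagrange's identity.\<close>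
  have "?P \<in> conway_set A"
    using acute[unfolded acute_triangle_iff[OF ccw]] unfolding conway_set_def A
    by (simp add: forall_3 inner_vec_def sum_2) algebra
  then show "a \<in> conway_edges ` conway_set A"
    unfolding a edge_lengths_conway by blast
next
  fix a assume "a \<in> conway_edges ` conway_set A"
  then obtain P where a: "a = conway_edges P" and P: "P \<in> conway_set A" by blast
  have pos: "0 < P$1" "0 < P$2" "0 < P$3" and area: "P$1 * P$2 + P$2 * P$3 + P$3 * P$1 = (2 * A)\<^sup>2"
    using P unfolding conway_set_def by auto
  define s where "s = sqrt (P$2 + P$3)"
  have s: "s > 0" "s * s = P$2 + P$3" using pos by (simp_all add: s_def)
  \<comment> \<open>The edge opposite \<open>p\<close> lies on the first axis and has length
    \<open>s\<close>. The height \<open>2 * A / s\<close> gives the area, and the abscissa of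
    \<open>p\<close> gives the dot product \<open>P$2\<close> at \<open>q\<close>.\<close>
  define p q r :: "real^2" where "p = vector [P$2 / s, 2 * A / s]" and "q = vector [0, 0]"
    and "r = vector [s, 0]"
  have det: "(q$1 - p$1) * (r$2 - p$2) - (q$2 - p$2) * (r$1 - p$1) = 2 * A"
    using s by (simp add: p_def q_def r_def algebra_simps)
  then have ccw: "ccw_triangle p q r" using assms by (simp add: ccw_triangle_iff)
  have "(q - p) \<bullet> (r - p) = (P$2 * P$2 + (2 * A)\<^sup>2) / (s * s) - P$2"
    using s(1) by (simp add: p_def q_def r_def inner_vec_def sum_2 field_simps power2_eq_square)
  \<comment> \<open>After \<open>(2 * A)\<^sup>2\<close> is replaced by the quadratic form, the
    numerator factors as \<open>(P$2 + P$1) * (P$2 + P$3)\<close>.\<close>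
  also have "\<dots> = P$1"
    unfolding area[symmetric] s(2) using pos by (simp add: field_simps)
  finally have 1: "(q - p) \<bullet> (r - p) = P$1" .
  have 2: "(r - q) \<bullet> (p - q) = P$2"
    using s by (simp add: p_def q_def r_def inner_vec_def sum_2)
  have 3: "(p - r) \<bullet> (q - r) = P$3"
    using s by (simp add: p_def q_def r_def inner_vec_def sum_2 field_simps)
  have "edge_lengths p q r = a"
    unfolding edge_lengths_conway a 1 2 3
    by (rule arg_cong[of _ _ conway_edges]) (simp add: vec_eq_iff forall_3)
  moreover have "acute_triangle p q r" unfolding acute_triangle_iff[OF ccw] 1 2 3 using pos by simp
  moreover have "measure lborel (convex hull {p, q, r}) = A"
    using ccw_triangle_measure[OF ccw] det by simp
  ultimately show "a \<in> acute_triangles A"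
    unfolding acute_triangles_def using ccw by blast
qed

lemma acute_triangles_pos: "A > 0 \<Longrightarrow> a \<in> acute_triangles A \<Longrightarrow> 0 < a$i"
  by (auto simp: acute_triangles_eq_image conway_edges_pos)

text \<open>Expresses membership through \<open>a\<close> alone, so that the equation of
  \<open>conway_set\<close> can be differentiated along a curve.\<close>

lemma acute_triangles_iff:
  assumes "A > 0"
  shows "a \<in> acute_triangles A \<longleftrightarrow> (\<forall>i. 0 < a$i) \<and> conway_params a \<in> conway_set A"
  using assms conway_edges_params[of a]
  by (auto simp: acute_triangles_eq_image conway_edges_pos conway_params_edges)
    (metis image_eqI)

section \<open>Curves along which two Conway parameters move linearly\<close>

lemma has_vector_derivative_vecI:
  fixes f :: "real \<Rightarrow> real^'n"
  assumes "\<And>i. ((\<lambda>t. f t $ i) has_real_derivative f' $ i) (at x within S)"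
  shows "(f has_vector_derivative f') (at x within S)"
  unfolding has_vector_derivative_def
  by (subst has_derivative_componentwise_within)
    (use assms in \<open>auto simp: Basis_vec_def inner_axis has_field_derivative_def mult.commute[of _ "f' $ _"]\<close>)

lemma has_vector_derivative_vec_nth:
  fixes f :: "real \<Rightarrow> real^'n"
  assumes "(f has_vector_derivative f') (at x within S)"
  shows "((\<lambda>t. f t $ i) has_real_derivative f' $ i) (at x within S)"
  using bounded_linear.has_vector_derivative[OF bounded_linear_vec_nth assms]
  by (simp add: has_real_derivative_iff_has_vector_derivative)

text \<open>The point of \<open>conway_set A\<close> whose \<open>j\<close>th and \<open>k\<close>th coordinates are \<open>y\<close> and \<open>z\<close>.\<close>

definition conway_graph :: "real \<Rightarrow> 3 \<Rightarrow> 3 \<Rightarrow> real \<Rightarrow> real \<Rightarrow> real^3" where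
  "conway_graph A j k y z =
    (\<chi> l. if l = j then y else if l = k then z else ((2 * A)\<^sup>2 - y * z) / (y + z))"

text \<open>The velocity of \<open>conway_graph\<close> when \<open>y\<close> and \<open>z\<close>
  move with speeds \<open>b\<close> and \<open>c\<close>; the last case is the quotient
  rule.\<close>

definition conway_graph_deriv ::
    "real \<Rightarrow> 3 \<Rightarrow> 3 \<Rightarrow> real \<Rightarrow> real \<Rightarrow> real \<Rightarrow> real \<Rightarrow> real^3" where
  "conway_graph_deriv A j k y z b c =
    (\<chi> l. if l = j then b else if l = k then c
          else - (b * ((2 * A)\<^sup>2 + z\<^sup>2) + c * ((2 * A)\<^sup>2 + y\<^sup>2)) / (y + z)\<^sup>2)"

text \<open>The differential of \<open>conway_edges\<close> at \<open>p\<close> in direction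
  \<open>d\<close>, from differentiating
  \<open>a\<^sub>l\<^sup>2 = p\<^sub>j + p\<^sub>k\<close>.\<close>

definition conway_edges_deriv :: "real^3 \<Rightarrow> real^3 \<Rightarrow> real^3" where
  "conway_edges_deriv p d = (\<chi> l. ((\<Sum>m\<in>UNIV. d$m) - d$l) / (2 * conway_edges p $ l))"

text \<open>The bound on \<open>y * z\<close> makes the solved coordinate positive.\<close>

lemma conway_graph_mem:
  assumes "i \<noteq> j" "j \<noteq> k" "i \<noteq> k" "0 < y" "0 < z" "y * z < (2 * A)\<^sup>2"
  shows "conway_graph A j k y z \<in> conway_set A"
proof -
  define w where "w = ((2 * A)\<^sup>2 - y * z) / (y + z)"
  have "0 < w" "w * (y + z) = (2 * A)\<^sup>2 - y * z"
    using assms(4-6) by (simp_all add: w_def)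
  moreover have "w * y + y * z + z * w = w * (y + z) + y * z" by (simp add: algebra_simps)
  moreover have "conway_graph A j k y z $ i = w" "conway_graph A j k y z $ j = y"
    "conway_graph A j k y z $ k = z"
    using assms(1-3) by (auto simp: conway_graph_def w_def)
  ultimately show ?thesis
    using assms(4,5) unfolding conway_set_distinct3[OF assms(1-3)] by simp
qed

text \<open>With two coordinates fixed, the quadratic equation is linear in the third and determines
  it.\<close>

lemma conway_graph_self:
  assumes "i \<noteq> j" "j \<noteq> k" "i \<noteq> k" "p \<in> conway_set A"
  shows "conway_graph A j k (p$j) (p$k) = p"
proof -
  have p: "0 < p$i" "0 < p$j" "0 < p$k" "p$i * p$j + p$j * p$k + p$k * p$i = (2 * A)\<^sup>2"
    using assms(4) unfolding conway_set_distinct3[OF assms(1-3)] by auto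
  have "((2 * A)\<^sup>2 - p$j * p$k) / (p$j + p$k) = p$i"
    unfolding p(4)[symmetric] using p(1-3) by (simp add: field_simps)
  then have "conway_graph A j k (p$j) (p$k) $ l = p $ l" for l
    using exhaust_distinct3[OF assms(1-3), of l] assms(1-3) by (auto simp: conway_graph_def)
  then show ?thesis by (simp add: vec_eq_iff)
qed

text \<open>Implicit differentiation of \<open>w * (y + z) + y * z = (2 * A)\<^sup>2\<close>, where
  \<open>w\<close> is the solved coordinate.\<close>

lemma conway_graph_deriv_solves:
  assumes "i \<noteq> j" "j \<noteq> k" "i \<noteq> k" "0 < y" "0 < z"
  shows "conway_graph_deriv A j k y z b c $ i * (y + z)
    + b * (conway_graph A j k y z $ i + z) + c * (conway_graph A j k y z $ i + y) = 0"
  using assms by (simp add: conway_graph_def conway_graph_deriv_def divide_simps)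
    (simp add: algebra_simps power2_eq_square)

lemma conway_set_mult_less:
  assumes "i \<noteq> j" "j \<noteq> k" "i \<noteq> k" "p \<in> conway_set A"
  shows "p$j * p$k < (2 * A)\<^sup>2"
proof -
  have "0 < p$i * p$j + p$k * p$i"
    using assms(4) unfolding conway_set_distinct3[OF assms(1-3)] by (simp add: add_pos_pos)
  then show ?thesis
    using assms(4) unfolding conway_set_distinct3[OF assms(1-3)] by linarith
qed

lemma has_vector_derivative_conway_edges:
  assumes "f x \<in> conway_set A" "(f has_vector_derivative f') (at x within S)"
  shows "((\<lambda>t. conway_edges (f t)) has_vector_derivative conway_edges_deriv (f x) f') (at x within S)"
proof (rule has_vector_derivative_vecI)
  fix i
  have pos: "0 < (\<Sum>m\<in>UNIV. f x $ m) - f x $ i"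
    using conway_edges_pos[OF assms(1), of i] by (simp add: conway_edges_def)
  have "((\<lambda>t. sqrt ((\<Sum>m\<in>UNIV. f t $ m) - f t $ i)) has_real_derivative
      ((\<Sum>m\<in>UNIV. f' $ m) - f' $ i) * (inverse (sqrt ((\<Sum>m\<in>UNIV. f x $ m) - f x $ i)) / 2)) (at x within S)"
    by (rule DERIV_real_sqrt[THEN DERIV_chain2, THEN DERIV_cong])
      (use pos in \<open>auto intro!: derivative_eq_intros has_vector_derivative_vec_nth[OF assms(2)]\<close>)
  then show "((\<lambda>t. conway_edges (f t) $ i) has_real_derivative conway_edges_deriv (f x) f' $ i) (at x within S)"
    by (simp add: conway_edges_def conway_edges_deriv_def field_simps)
qed

text \<open>Serves twice: on an open interval around 0 to realize tangent vectors, and on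
  \<open>{0..1}\<close> to join two triangles.\<close>

lemma conway_line_C1:
  fixes y0 z0 b c :: real
  assumes dist: "i \<noteq> j" "j \<noteq> k" "i \<noteq> k"
    and pos: "\<forall>t\<in>S. 0 < y0 + t * b \<and> 0 < z0 + t * c \<and> (y0 + t * b) * (z0 + t * c) < (2 * A)\<^sup>2"
  defines "f \<equiv> \<lambda>t. conway_graph A j k (y0 + t * b) (z0 + t * c)"
    and "f' \<equiv> \<lambda>t. conway_graph_deriv A j k (y0 + t * b) (z0 + t * c) b c"
  shows "\<And>t. t \<in> S \<Longrightarrow>
      ((\<lambda>t. conway_edges (f t)) has_vector_derivative conway_edges_deriv (f t) (f' t)) (at t)"
    and "continuous_on S (\<lambda>t. conway_edges_deriv (f t) (f' t))"
    and "\<And>t. t \<in> S \<Longrightarrow> f t \<in> conway_set A"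
proof -
  show mem: "f t \<in> conway_set A" if "t \<in> S" for t
    unfolding f_def using conway_graph_mem[OF dist] bspec[OF pos that] by blast
  have der: "(f has_vector_derivative f' t) (at t)" if "t \<in> S" for t
  proof (rule has_vector_derivative_vecI)
    fix l
    have nz: "y0 + t * b + (z0 + t * c) \<noteq> 0" using bspec[OF pos that] by linarith
    have "((\<lambda>t. ((2 * A)\<^sup>2 - (y0 + t * b) * (z0 + t * c)) / (y0 + t * b + (z0 + t * c))) has_real_derivative
      - (b * ((2 * A)\<^sup>2 + (z0 + t * c)\<^sup>2) + c * ((2 * A)\<^sup>2 + (y0 + t * b)\<^sup>2)) / (y0 + t * b + (z0 + t * c))\<^sup>2) (at t)"
      by (rule derivative_eq_intros refl nz)+ (use nz in \<open>simp add: divide_simps\<close>, simp add: algebra_simps power2_eq_square)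
    moreover have "((\<lambda>t. y0 + t * b) has_real_derivative b) (at t)"
      "((\<lambda>t. z0 + t * c) has_real_derivative c) (at t)"
      by (auto intro!: derivative_eq_intros)
    ultimately show "((\<lambda>t. f t $ l) has_real_derivative f' t $ l) (at t)"
      by (simp add: f_def f'_def conway_graph_def conway_graph_deriv_def)
  qed
  then show "((\<lambda>t. conway_edges (f t)) has_vector_derivative conway_edges_deriv (f t) (f' t)) (at t)"
    if "t \<in> S" for t
    using has_vector_derivative_conway_edges mem that by blast
  have nz: "y0 + t * b + (z0 + t * c) \<noteq> 0" if "t \<in> S" for t using bspec[OF pos that] by linarith
  have "continuous_on S (\<lambda>t. f' t $ l)" for l
  proof -
    have "continuous_on S (\<lambda>t. - (b * ((2 * A)\<^sup>2 + (z0 + t * c)\<^sup>2) + c * ((2 * A)\<^sup>2 + (y0 + t * b)\<^sup>2)) / (y0 + t * b + (z0 + t * c))\<^sup>2)"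
      using nz by (intro continuous_intros) auto
    then show ?thesis
      unfolding f'_def conway_graph_deriv_def vec_lambda_beta
      by (cases "l = j"; cases "l = k") (simp_all only: if_True if_False simp_thms continuous_on_const)
  qed
  moreover have "continuous_on S (\<lambda>t. conway_edges (f t) $ l)" for l
    using has_vector_derivative_conway_edges[OF mem der]
    by (intro continuous_on_component continuous_at_imp_continuous_on)
      (auto dest: has_vector_derivative_continuous)
  moreover have "2 * conway_edges (f t) $ l \<noteq> 0" if "t \<in> S" for t l
    using conway_edges_pos[OF mem[OF that], of l] by simp
  ultimately show "continuous_on S (\<lambda>t. conway_edges_deriv (f t) (f' t))"
    unfolding conway_edges_deriv_def
    by (intro continuous_on_vec_lambda continuous_on_divide continuous_on_diff continuous_on_sum
        continuous_on_mult continuous_on_const) auto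
qed

section \<open>Tangent spaces in the edge model\<close>

text \<open>
  The derivative at \<open>a\<close> in direction \<open>v\<close> of Heron's polynomial
  \<open>p\<^sub>1p\<^sub>2 + p\<^sub>2p\<^sub>3 + p\<^sub>3p\<^sub>1\<close>; the factor before \<open>(a$l)\<^sup>2\<close> is the derivative of \<open>p\<^sub>l\<close>.
\<close>

definition area_gradient :: "real^3 \<Rightarrow> real^3 \<Rightarrow> real" where
  "area_gradient a v =
    (\<Sum>l\<in>UNIV. ((\<Sum>m\<in>UNIV. a$m * v$m) - 2 * a$l * v$l) * (a$l)\<^sup>2)"

text \<open>One inclusion differentiates the area equation along a curve. For the other, two Conway
  parameters move linearly with the speeds that \<open>v\<close> prescribes, and the equation forces
  the third speed.\<close>

lemma tangent_space_acute_triangles: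
  assumes A: "A > 0" and a: "a \<in> acute_triangles A"
  shows "tangent_space (acute_triangles A) a = {v. area_gradient a v = 0}"
proof (intro equalityI subsetI CollectI)
  fix v assume "v \<in> tangent_space (acute_triangles A) a"
  then obtain c e where e: "e > 0" and c: "c ` {-e<..<e} \<subseteq> acute_triangles A" "c 0 = a"
    and der: "(c has_vector_derivative v) (at 0)"
    unfolding tangent_space_def by blast
  define Q where "Q t = conway_params (c t)" for t
  define d where "d l = (\<Sum>m\<in>UNIV. a$m * v$m) - 2 * a$l * v$l" for l
  have dQ: "((\<lambda>t. Q t $ l) has_real_derivative d l) (at 0)" for l
    unfolding Q_def conway_params_def d_def
    by (auto intro!: derivative_eq_intros has_vector_derivative_vec_nth[OF der]
        simp: c(2) sum_distrib_left sum_divide_distrib algebra_simps)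
  have const: "Q t $ 1 * Q t $ 2 + Q t $ 2 * Q t $ 3 + Q t $ 3 * Q t $ 1 = (2 * A)\<^sup>2" if "\<bar>t\<bar> < e" for t
  proof -
    have "c t \<in> acute_triangles A" using c(1) that unfolding image_subset_iff by (simp add: abs_less_iff)
    then show ?thesis unfolding Q_def by (simp add: acute_triangles_iff[OF A] conway_set_def)
  qed
  have "((\<lambda>t. Q t $ 1 * Q t $ 2 + Q t $ 2 * Q t $ 3 + Q t $ 3 * Q t $ 1) has_real_derivative
      (d 1 * Q 0 $ 2 + d 2 * Q 0 $ 1) + (d 2 * Q 0 $ 3 + d 3 * Q 0 $ 2) + (d 3 * Q 0 $ 1 + d 1 * Q 0 $ 3)) (at 0)"
    by (auto intro!: derivative_eq_intros dQ)
  then have "(d 1 * Q 0 $ 2 + d 2 * Q 0 $ 1) + (d 2 * Q 0 $ 3 + d 3 * Q 0 $ 2) + (d 3 * Q 0 $ 1 + d 1 * Q 0 $ 3) = 0"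
    by (rule DERIV_local_const[OF _ e]) (simp add: const e)
  \<comment> \<open>The coefficient of \<open>d l\<close> is the sum of the other two parameters,
    which is \<open>(a$l)\<^sup>2\<close>.\<close>
  then show "area_gradient a v = 0"
    unfolding area_gradient_def d_def[symmetric]
    by (simp add: Q_def c(2) conway_params_def sum_3 field_simps)
next
  fix v assume "v \<in> {v. area_gradient a v = 0}"
  then have v: "area_gradient a v = 0" by simp
  obtain p where p: "p \<in> conway_set A" and ap: "a = conway_edges p"
    using a by (auto simp: acute_triangles_eq_image[OF A])
  have ppos: "0 < p$1" "0 < p$2" "0 < p$3" using p by (auto simp: conway_set_def)
  define d where "d = (\<chi> l. (\<Sum>m\<in>UNIV. a$m * v$m) - 2 * a$l * v$l)"
  have sq: "(a$1)\<^sup>2 = p$2 + p$3" "(a$2)\<^sup>2 = p$1 + p$3" "(a$3)\<^sup>2 = p$1 + p$2"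
    using ppos by (simp_all add: ap conway_edges_def sum_3)
  have dp: "d$1 * (p$2 + p$3) + d$2 * (p$1 + p$3) + d$3 * (p$1 + p$2) = 0"
    using v unfolding area_gradient_def by (simp add: sum_3[of "\<lambda>l. _ l * _ l"] sq d_def)
  define f where "f t = conway_graph A 2 3 (p$2 + t * d$2) (p$3 + t * d$3)" for t
  define f' where "f' t = conway_graph_deriv A 2 3 (p$2 + t * d$2) (p$3 + t * d$3) (d$2) (d$3)" for t
  \<comment> \<open>The times at which the line stays in the domain of the graph: an open set
    containing 0.\<close>
  define T where "T = {t. 0 < p$2 + t * d$2} \<inter> {t. 0 < p$3 + t * d$3} \<inter>
    {t. (p$2 + t * d$2) * (p$3 + t * d$3) < (2 * A)\<^sup>2}"
  have "open T" unfolding T_def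
    by (intro open_Int open_Collect_less continuous_intros)
  moreover have "0 \<in> T"
    using ppos conway_set_mult_less[of 1 2 3, OF _ _ _ p] by (simp add: T_def)
  ultimately obtain e where e: "e > 0" "ball 0 e \<subseteq> T" by (meson openE)
  then have sub: "{-e<..<e} \<subseteq> T" by (simp add: ball_eq_greaterThanLessThan)
  note line = conway_line_C1[of 1 2 3 "{-e<..<e}" "p$2" "d$2" "p$3" "d$3" A, folded f_def f'_def]
  have pos: "\<forall>t\<in>{-e<..<e}. 0 < p$2 + t * d$2 \<and> 0 < p$3 + t * d$3 \<and>
      (p$2 + t * d$2) * (p$3 + t * d$3) < (2 * A)\<^sup>2"
    using sub unfolding T_def by blast
  have f0: "f 0 = p" using conway_graph_self[of 1 2 3, OF _ _ _ p] by (simp add: f_def)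
  have "f' 0 $ 1 * (p$2 + p$3) + d$2 * (p$1 + p$3) + d$3 * (p$1 + p$2) = 0"
    using conway_graph_deriv_solves[of 1 2 3 "p$2" "p$3" A "d$2" "d$3"] ppos f0
    by (simp add: f_def f'_def)
  \<comment> \<open>\<open>d$1\<close> and the first speed of the curve solve the same linear
    equation.\<close>
  with dp have "f' 0 $ 1 * (p$2 + p$3) = d$1 * (p$2 + p$3)" by linarith
  with ppos have "f' 0 $ 1 = d$1" by simp
  then have f'0: "f' 0 = d" by (simp add: vec_eq_iff forall_3 f'_def conway_graph_deriv_def)
  have apos: "0 < a$l" for l using a A acute_triangles_pos by blast
  \<comment> \<open>The entries of \<open>d\<close> other than the \<open>l\<close>th add up to
    \<open>2 * a$l * v$l\<close>.\<close>
  have "conway_edges_deriv p d $ l = v $ l" for l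
    using apos[of l] by (simp add: conway_edges_deriv_def ap[symmetric] d_def field_simps sum_3)
  then have "conway_edges_deriv (f 0) (f' 0) = v" by (simp add: vec_eq_iff f0 f'0)
  moreover have "0 \<in> {-e<..<e}" using e by simp
  ultimately have "((\<lambda>t. conway_edges (f t)) has_vector_derivative v) (at 0)"
    using line(1)[OF _ _ _ pos, of 0] by auto
  moreover have "(\<lambda>t. conway_edges (f t)) C1_differentiable_on {-e<..<e}"
    unfolding C1_differentiable_on_def using line(1,2)[OF _ _ _ pos]
    by (intro exI[of _ "\<lambda>t. conway_edges_deriv (f t) (f' t)"]) auto
  moreover have "(\<lambda>t. conway_edges (f t)) ` {-e<..<e} \<subseteq> acute_triangles A"
    unfolding acute_triangles_eq_image[OF A] using line(3)[OF _ _ _ pos] by auto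
  ultimately show "v \<in> tangent_space (acute_triangles A) a"
    unfolding tangent_space_def using e(1) f0 ap by blast
qed

lemma subspace_tangent_space_acute_triangles:
  assumes "A > 0" "a \<in> acute_triangles A"
  shows "subspace (tangent_space (acute_triangles A) a)"
proof -
  have "linear (area_gradient a)"
    by (rule linearI) (simp_all add: area_gradient_def sum_3 algebra_simps)
  then show ?thesis
    unfolding tangent_space_acute_triangles[OF assms] by (rule linear_subspace_kernel)
qed

section \<open>The Finsler structure\<close>

lemma F_edge_max: "F_edge a v = max (\<bar>v$1\<bar> / a$1) (max (\<bar>v$2\<bar> / a$2) (\<bar>v$3\<bar> / a$3))"
  by (simp add: F_edge_def)

lemma F_edge_le_iff: "F_edge a v \<le> r \<longleftrightarrow> (\<forall>i. \<bar>v$i\<bar> / a$i \<le> r)"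
  by (simp add: F_edge_max forall_3)

lemma F_edge_ge: "\<bar>v$i\<bar> / a$i \<le> F_edge a v"
  using F_edge_le_iff by blast

lemma continuous_on_F_edge:
  assumes "continuous_on S f" "continuous_on S g" "\<And>x i. x \<in> S \<Longrightarrow> f x $ i \<noteq> 0"
  shows "continuous_on S (\<lambda>x. F_edge (f x) (g x))"
  unfolding F_edge_max using assms by (intro continuous_intros) auto

text \<open>\<open>F_edge a\<close> is the sup norm after rescaling the \<open>i\<close>th
  coordinate by \<open>1 / a$i\<close>, restricted to \<open>V\<close>.\<close>

lemma weak_norm_on_F_edge:
  assumes "subspace V" and pos: "\<And>i. 0 < a$i"
  shows "weak_norm_on V (F_edge a)"
  unfolding weak_norm_on_def
proof (intro conjI ballI allI impI)
  show "subspace V" by fact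
next
  fix v :: "real^3"
  have "0 \<le> \<bar>v$1\<bar> / a$1" using pos[of 1] by simp
  with F_edge_ge[of v 1 a] show "0 \<le> F_edge a v" by linarith
next
  fix v :: "real^3"
  have "F_edge a v \<le> 0 \<longleftrightarrow> v = 0"
    unfolding F_edge_le_iff vec_eq_iff using pos by (simp add: divide_le_0_iff less_le_not_le)
  moreover have "0 \<le> F_edge a v" using F_edge_ge[of v 1 a] pos[of 1] by (simp add: order.trans[rotated])
  ultimately show "F_edge a v = 0 \<longleftrightarrow> v = 0" by auto
next
  fix v :: "real^3" and t :: real assume "0 < t"
  then show "F_edge a (t *\<^sub>R v) = t * F_edge a v"
    by (simp add: F_edge_max abs_mult max_mult_distrib_left)
next
  fix v w :: "real^3" and t :: real assume t: "t \<in> {0..1}"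
  show "F_edge a (t *\<^sub>R v + (1 - t) *\<^sub>R w) \<le> t * F_edge a v + (1 - t) * F_edge a w"
    unfolding F_edge_le_iff
  proof
    fix i
    have "\<bar>(t *\<^sub>R v + (1 - t) *\<^sub>R w) $ i\<bar> / a$i \<le> (t * \<bar>v$i\<bar> + (1 - t) * \<bar>w$i\<bar>) / a$i"
      using t pos[of i] abs_triangle_ineq[of "t * v$i" "(1 - t) * w$i"]
      by (intro divide_right_mono) (simp_all add: abs_mult)
    also have "\<dots> = t * (\<bar>v$i\<bar> / a$i) + (1 - t) * (\<bar>w$i\<bar> / a$i)"
      by (simp add: add_divide_distrib)
    also have "\<dots> \<le> t * F_edge a v + (1 - t) * F_edge a w"
      using t by (intro add_mono mult_left_mono F_edge_ge) auto
    finally show "\<bar>(t *\<^sub>R v + (1 - t) *\<^sub>R w) $ i\<bar> / a$i \<le> t * F_edge a v + (1 - t) * F_edge a w" .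
  qed
qed

lemma finsler_structure_F_edge:
  assumes "A > 0"
  shows "finsler_structure (acute_triangles A) F_edge"
  unfolding finsler_structure_def
proof (intro conjI ballI)
  have "continuous_on (tangent_bundle (acute_triangles A)) (\<lambda>z. F_edge (fst z) (snd z))"
    by (intro continuous_on_F_edge continuous_intros)
      (use acute_triangles_pos[OF assms] in \<open>fastforce simp: tangent_bundle_def less_le\<close>)
  then show "continuous_on (tangent_bundle (acute_triangles A)) (\<lambda>(x, v). F_edge x v)"
    by (simp add: case_prod_beta)
next
  fix a assume "a \<in> acute_triangles A"
  then show "weak_norm_on (tangent_space (acute_triangles A) a) (F_edge a)"
    by (intro weak_norm_on_F_edge subspace_tangent_space_acute_triangles assms
        acute_triangles_pos[OF assms])
qed

section \<open>The metric\<close>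

lemma m_dist_le_iff:
  assumes pos: "\<And>i. 0 < a$i" "\<And>i. 0 < b$i"
  shows "m_dist a b \<le> r \<longleftrightarrow> (\<forall>i. \<bar>ln (a$i) - ln (b$i)\<bar> \<le> r)"
proof -
  let ?S = "{a$1 / b$1, b$1 / a$1, a$2 / b$2, b$2 / a$2, a$3 / b$3, b$3 / a$3}"
  \<comment> \<open>Positivity of the maximum is what lets \<open>exp\<close> undo
    \<open>ln\<close>.\<close>
  have "0 < a$1 / b$1" using pos by simp
  also have "\<dots> \<le> Max ?S" by (rule Max_ge) auto
  finally have "m_dist a b \<le> r \<longleftrightarrow> Max ?S \<le> exp r"
    unfolding m_dist_def by (metis exp_le_cancel_iff exp_ln)
  also have "\<dots> \<longleftrightarrow> (\<forall>x\<in>?S. x \<le> exp r)" by (rule Max_le_iff) auto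
  also have "\<dots> \<longleftrightarrow> (\<forall>i. a$i / b$i \<le> exp r \<and> b$i / a$i \<le> exp r)"
    unfolding forall_3 by auto
  also have "\<dots> \<longleftrightarrow> (\<forall>i. \<bar>ln (a$i) - ln (b$i)\<bar> \<le> r)"
  proof -
    have "x / y \<le> exp r \<longleftrightarrow> ln x - ln y \<le> r" if "0 < x" "0 < y" for x y :: real
      using that ln_le_cancel_iff[of "x / y" "exp r"] by (simp add: ln_div)
    then show ?thesis using pos by (auto simp: abs_le_iff)
  qed
  finally show ?thesis .
qed

text \<open>\<open>m_dist\<close> is the sup distance between the coordinatewise logarithms, and
  \<open>ln\<close> is injective on positive numbers.\<close>

lemma metric_on_m_dist:
  assumes pos: "\<And>a i. a \<in> M \<Longrightarrow> 0 < a$i"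
  shows "metric_on M m_dist"
proof -
  have le: "m_dist a b \<le> r \<longleftrightarrow> (\<forall>i. \<bar>ln (a$i) - ln (b$i)\<bar> \<le> r)" if "a \<in> M" "b \<in> M" for a b r
    using m_dist_le_iff pos that by blast
  have ge: "\<bar>ln (a$i) - ln (b$i)\<bar> \<le> m_dist a b" if "a \<in> M" "b \<in> M" for a b i
    using le[OF that, of "m_dist a b"] by blast
  have nonneg: "0 \<le> m_dist a b" if "a \<in> M" "b \<in> M" for a b
    using ge[OF that, of 1] by linarith
  have comm: "m_dist a b = m_dist b a" if "a \<in> M" "b \<in> M" for a b
  proof (rule order.antisym)
    show "m_dist a b \<le> m_dist b a"
      unfolding le[OF that] using ge[OF that(2,1)] by (subst abs_minus_commute) blast
    show "m_dist b a \<le> m_dist a b"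
      unfolding le[OF that(2,1)] using ge[OF that] by (subst abs_minus_commute) blast
  qed
  have zero: "m_dist a b = 0 \<longleftrightarrow> a = b" if "a \<in> M" "b \<in> M" for a b
  proof -
    have "m_dist a b = 0 \<longleftrightarrow> m_dist a b \<le> 0" using nonneg[OF that] by auto
    also have "\<dots> \<longleftrightarrow> (\<forall>i. ln (a$i) = ln (b$i))" unfolding le[OF that] by simp
    finally have "m_dist a b = 0 \<longleftrightarrow> (\<forall>i. ln (a$i) = ln (b$i))" .
    then show ?thesis using pos that by (simp add: vec_eq_iff)
  qed
  have tri: "m_dist a c \<le> m_dist a b + m_dist b c" if "a \<in> M" "b \<in> M" "c \<in> M" for a b c
    unfolding le[OF that(1,3)]
  proof
    fix i show "\<bar>ln (a$i) - ln (c$i)\<bar> \<le> m_dist a b + m_dist b c"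
      using ge[OF that(1,2), of i] ge[OF that(2,3), of i] by linarith
  qed
  show ?thesis
    unfolding metric_on_def by standard (use nonneg comm zero tri in auto)
qed

section \<open>Lower bound for the length of curves\<close>

lemma has_integral_log_derivative:
  fixes c :: "real \<Rightarrow> real^'n"
  assumes "u \<le> v"
    and der: "\<And>t. t \<in> {u..v} \<Longrightarrow> (c has_vector_derivative c' t) (at t within {u..v})"
    and pos: "\<And>t. t \<in> {u..v} \<Longrightarrow> 0 < c t $ i"
  shows "((\<lambda>t. c' t $ i / c t $ i) has_integral ln (c v $ i) - ln (c u $ i)) {u..v}"
proof (rule fundamental_theorem_of_calculus[OF assms(1)])
  fix t assume t: "t \<in> {u..v}"
  show "((\<lambda>t. ln (c t $ i)) has_vector_derivative c' t $ i / c t $ i) (at t within {u..v})"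
    unfolding has_real_derivative_iff_has_vector_derivative[symmetric]
    using pos[OF t]
    by (auto intro!: derivative_eq_intros has_vector_derivative_vec_nth[OF der[OF t]])
qed

text \<open>Integrates the bound of the \<open>i\<close>th logarithmic derivative by
  \<open>F_edge\<close>. The derivative in \<open>g\<close> is relative to all of
  \<open>{a..b}\<close>, so that bounds for adjacent pieces add up.\<close>

lemma C1_curve_F_edge_length:
  assumes "u < v" "a \<le> u" "v \<le> b" and C1: "C1_curve u v c"
    and pos: "\<And>t i. t \<in> {u..v} \<Longrightarrow> 0 < c t $ i"
  defines "g \<equiv> \<lambda>t. F_edge (c t) (vector_derivative c (at t within {a..b}))"
  shows "g integrable_on {u..v} \<and> \<bar>ln (c v $ i) - ln (c u $ i)\<bar> \<le> integral {u..v} g"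
proof -
  obtain c' where c': "continuous_on {u..v} c'"
    and der: "\<And>t. t \<in> {u..v} \<Longrightarrow> (c has_vector_derivative c' t) (at t within {u..v})"
    using C1 unfolding C1_curve_def by blast
  define h where "h t = F_edge (c t) (c' t)" for t
  \<comment> \<open>At \<open>u\<close> and \<open>v\<close> the curve may have a corner and
    \<open>g\<close> may differ from \<open>h\<close>; two points do not affect the
    integral.\<close>
  have gh: "g t = h t" if "t \<in> {u..v} - {u, v}" for t
  proof -
    have "(c has_vector_derivative c' t) (at t within {u..v})" using der that by auto
    moreover have "at t within {u..v} = at t" using that by (simp add: at_within_Icc_at)
    moreover have "at t within {a..b} = at t" using that assms(1-3) by (simp add: at_within_Icc_at)
    ultimately show ?thesis
      unfolding g_def h_def by (simp add: vector_derivative_at)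
  qed
  have "continuous_on {u..v} c"
    unfolding continuous_on_eq_continuous_within
    using der by (blast intro: has_vector_derivative_continuous)
  then have "continuous_on {u..v} h"
    unfolding h_def using c' pos by (intro continuous_on_F_edge) (auto simp: less_le)
  then have h: "h integrable_on {u..v}" by (rule integrable_continuous_real)
  have "((\<lambda>t. c' t $ i / c t $ i) has_integral ln (c v $ i) - ln (c u $ i)) {u..v}"
    by (rule has_integral_log_derivative) (use assms(1) der pos in auto)
  moreover from this h have "norm (integral {u..v} (\<lambda>t. c' t $ i / c t $ i)) \<le> integral {u..v} h"
  proof (rule integral_norm_bound_integral[OF has_integral_integrable])
    fix t assume t: "t \<in> {u..v}"
    show "norm (c' t $ i / c t $ i) \<le> h t"
      using F_edge_ge[of "c' t" i "c t"] pos[OF t, of i] by (simp add: h_def)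
  qed
  ultimately have "\<bar>ln (c v $ i) - ln (c u $ i)\<bar> \<le> integral {u..v} h"
    by (simp add: integral_unique)
  moreover have "integral {u..v} g = integral {u..v} h"
    by (rule integral_spike[of "{u, v}"]) (use gh in auto)
  moreover have "g integrable_on {u..v}"
    by (rule integrable_spike_finite[of "{u, v}"]) (use gh h in auto)
  ultimately show ?thesis by simp
qed

text \<open>Induction over the breakpoints, adding one piece at a time. Integrability is stated too,
  for the later comparison of integrals.\<close>

lemma piecewise_C1_curve_F_edge_length:
  assumes "piecewise_C1_curve a b c" and pos: "\<And>t i. t \<in> {a..b} \<Longrightarrow> 0 < c t $ i"
  shows "(\<lambda>t. F_edge (c t) (vector_derivative c (at t within {a..b}))) integrable_on {a..b} \<and>
    \<bar>ln (c b $ i) - ln (c a $ i)\<bar> \<le> finsler_length F_edge a b c"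
proof -
  define g where "g t = F_edge (c t) (vector_derivative c (at t within {a..b}))" for t
  obtain n :: nat and s where s: "s 0 = a" "s n = b"
    and C1: "\<And>l. l < n \<Longrightarrow> s l < s (Suc l) \<and> C1_curve (s l) (s (Suc l)) c"
    using assms(1) unfolding piecewise_C1_curve_def by blast
  have mono: "s l \<le> s m" if "l \<le> m" "m \<le> n" for l m
    using that
  proof (induction m rule: dec_induct)
    case (step m)
    then show ?case using C1[of m] by force
  qed simp
  have "g integrable_on {a..s l} \<and> \<bar>ln (c (s l) $ i) - ln (c a $ i)\<bar> \<le> integral {a..s l} g" if "l \<le> n" for l
    using that
  proof (induction l)
    case 0
    show ?case using integrable_on_refl[of g a] by (simp add: s)
  next
    case (Suc l)
    have le: "a \<le> s l" "s (Suc l) \<le> b" "s l < s (Suc l)"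
      using mono[of 0 l] mono[of "Suc l" n] Suc.prems C1[of l] s by auto
    have IH: "g integrable_on {a..s l}" "\<bar>ln (c (s l) $ i) - ln (c a $ i)\<bar> \<le> integral {a..s l} g"
      using Suc by auto
    have piece: "g integrable_on {s l..s (Suc l)}"
      "\<bar>ln (c (s (Suc l)) $ i) - ln (c (s l) $ i)\<bar> \<le> integral {s l..s (Suc l)} g"
      using C1_curve_F_edge_length[OF le(3,1,2)] C1[of l] Suc.prems pos le
      unfolding g_def by auto
    have int: "g integrable_on {a..s (Suc l)}"
      by (rule Henstock_Kurzweil_Integration.integrable_combine[of _ "s l"]) (use le IH piece in auto)
    moreover have "integral {a..s l} g + integral {s l..s (Suc l)} g = integral {a..s (Suc l)} g"
      by (rule Henstock_Kurzweil_Integration.integral_combine) (use le int in auto)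
    ultimately show ?case using IH piece by linarith
  qed
  from this[of n] show ?thesis
    unfolding s g_def finsler_length_def by simp
qed

section \<open>Construction of shortest curves\<close>

text \<open>
  The equation says that \<open>(d, b, c)\<close> is tangent to \<open>conway_set A\<close> at \<open>(w, y, z)\<close>; the conclusion
  compares the logarithmic derivatives of \<open>w + z\<close> and \<open>y + z\<close>.
\<close>

lemma conway_deriv_bound:
  fixes w y z b c d :: real
  assumes "0 < w" "0 < y" "0 < z" "0 \<le> b * c"
    and "d * (y + z) + b * (w + z) + c * (w + y) = 0"
  shows "\<bar>d + c\<bar> * (y + z) \<le> \<bar>b + c\<bar> * (w + z)"
proof -
  have "\<bar>d + c\<bar> * (y + z) = \<bar>(d + c) * (y + z)\<bar>" using assms by (simp add: abs_mult)
  \<comment> \<open>The tangency equation eliminates \<open>d\<close>.\<close>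
  also have "(d + c) * (y + z) = c * (z - w) - b * (w + z)"
    using assms(5) by (simp add: algebra_simps)
  also have "\<bar>\<dots>\<bar> \<le> \<bar>c\<bar> * \<bar>z - w\<bar> + \<bar>b\<bar> * \<bar>w + z\<bar>"
    using abs_triangle_ineq4[of "c * (z - w)" "b * (w + z)"] by (simp add: abs_mult)
  also have "\<dots> \<le> \<bar>c\<bar> * (w + z) + \<bar>b\<bar> * (w + z)"
    using assms by (intro add_mono mult_left_mono) auto
  \<comment> \<open>Here \<open>b\<close> and \<open>c\<close> have the same weak sign.\<close>
  also have "\<dots> = \<bar>b + c\<bar> * (w + z)"
    using assms(4) by (auto simp: zero_le_mult_iff algebra_simps)
  finally show ?thesis .
qed

text \<open>The right-hand side is the absolute logarithmic derivative of the \<open>i\<close>th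
  edge, so this edge changes at the largest relative rate.\<close>

lemma F_edge_conway_deriv:
  assumes dist: "i \<noteq> j" "j \<noteq> k" "i \<noteq> k" and p: "p \<in> conway_set A"
    and d: "d$i * (p$j + p$k) + d$j * (p$i + p$k) + d$k * (p$i + p$j) = 0" "0 \<le> d$j * d$k"
  shows "F_edge (conway_edges p) (conway_edges_deriv p d) \<le> \<bar>d$j + d$k\<bar> / (2 * (p$j + p$k))"
  unfolding F_edge_le_iff
proof
  fix l
  have pos: "0 < p$i" "0 < p$j" "0 < p$k" using p unfolding conway_set_distinct3[OF dist] by auto
  define X where "X l = (\<Sum>m\<in>UNIV. p$m) - p$l" for l
  define D where "D l = (\<Sum>m\<in>UNIV. d$m) - d$l" for l
  have X: "X i = p$j + p$k" "X j = p$i + p$k" "X k = p$i + p$j"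
    and D: "D i = d$j + d$k" "D j = d$i + d$k" "D k = d$i + d$j"
    unfolding X_def D_def sum_distinct3[OF dist] by simp_all
  have Xpos: "0 < X l"
    using exhaust_distinct3[OF dist, of l] pos by (auto simp: X)
  \<comment> \<open>The case \<open>l = i\<close> is trivial; the two instances, with
    \<open>j\<close> and \<open>k\<close> exchanged, give \<open>l = j\<close> and
    \<open>l = k\<close>.\<close>
  have "\<bar>D l\<bar> * X i \<le> \<bar>D i\<bar> * X l"
    using exhaust_distinct3[OF dist, of l]
      conway_deriv_bound[of "p$i" "p$j" "p$k" "d$j" "d$k" "d$i"]
      conway_deriv_bound[of "p$i" "p$k" "p$j" "d$k" "d$j" "d$i"] pos d
    by (auto simp: X D algebra_simps)
  then have "\<bar>D l\<bar> / (2 * X l) \<le> \<bar>D i\<bar> / (2 * X i)"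
    using Xpos pos by (simp add: X(1) field_simps)
  moreover have "conway_edges p $ l = sqrt (X l)" by (simp add: conway_edges_def X_def)
  then have "\<bar>conway_edges_deriv p d $ l\<bar> / conway_edges p $ l = \<bar>D l\<bar> / (2 * X l)"
    using Xpos by (simp add: conway_edges_deriv_def D_def abs_mult real_sqrt_mult_self)
  ultimately show "\<bar>conway_edges_deriv p d $ l\<bar> / conway_edges p $ l \<le> \<bar>d$j + d$k\<bar> / (2 * (p$j + p$k))"
    by (simp add: X D)
qed

text \<open>The squared \<open>i\<close>th edge is \<open>p\<^sub>j + p\<^sub>k\<close>, which moves
  linearly, so its logarithmic derivative has constant sign and the integral of the absolute value
  telescopes.\<close>

lemma conway_line_length:
  assumes A: "A > 0" and dist: "i \<noteq> j" "j \<noteq> k" "i \<noteq> k"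
    and p: "p \<in> conway_set A" and q: "q \<in> conway_set A"
    and mono: "0 \<le> (q$j - p$j) * (q$k - p$k)"
  shows "\<exists>\<gamma>\<in>curves_between (acute_triangles A) (conway_edges p) (conway_edges q).
    finsler_length F_edge 0 1 \<gamma> \<le> \<bar>ln (conway_edges p $ i) - ln (conway_edges q $ i)\<bar>"
proof -
  define b where "b = q$j - p$j"
  define c where "c = q$k - p$k"
  define f where "f t = conway_graph A j k (p$j + t * b) (p$k + t * c)" for t
  define f' where "f' t = conway_graph_deriv A j k (p$j + t * b) (p$k + t * c) b c" for t
  define \<gamma> where "\<gamma> t = conway_edges (f t)" for t
  define \<gamma>' where "\<gamma>' t = conway_edges_deriv (f t) (f' t)" for t
  have pq: "0 < p$j" "0 < p$k" "0 < q$j" "0 < q$k"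
    using p q unfolding conway_set_distinct3[OF dist] by auto
  have pos: "\<forall>t\<in>{0..1}. 0 < p$j + t * b \<and> 0 < p$k + t * c \<and>
      (p$j + t * b) * (p$k + t * c) < (2 * A)\<^sup>2"
  proof
    fix t :: real assume t01: "t \<in> {0..1}"
    have conv: "p$l + t * (q$l - p$l) = (1 - t) * p$l + t * q$l" for l by (simp add: algebra_simps)
    have conv_pos: "0 < (1 - t) * x + t * y" if "0 < x" "0 < y" for x y :: real
      using convex_bound_lt[of "- x" 0 "- y" "1 - t" t] that t01 by simp
    have y: "0 < p$j + t * b" and z: "0 < p$k + t * c"
      unfolding b_def c_def conv using conv_pos pq by auto
    \<comment> \<open>Both factors move in the same weak direction, so their product is at most its
      value at one of the ends.\<close>
    have "(p$j + t * b) * (p$k + t * c) < (2 * A)\<^sup>2"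
    proof (cases "0 \<le> b \<and> 0 \<le> c")
      case True
      then have "p$j + t * b \<le> q$j" "p$k + t * c \<le> q$k"
        using mult_left_le_one_le[of b t] mult_left_le_one_le[of c t] t01 by (auto simp: b_def c_def)
      then have "(p$j + t * b) * (p$k + t * c) \<le> q$j * q$k" using y z pq by (intro mult_mono) auto
      with conway_set_mult_less[OF dist q] show ?thesis by linarith
    next
      case False
      then have "b \<le> 0" "c \<le> 0" using mono by (auto simp: b_def c_def zero_le_mult_iff)
      then have "p$j + t * b \<le> p$j" "p$k + t * c \<le> p$k"
        using t01 by (auto simp: mult_nonneg_nonpos)
      then have "(p$j + t * b) * (p$k + t * c) \<le> p$j * p$k" using y z pq by (intro mult_mono) auto
      with conway_set_mult_less[OF dist p] show ?thesis by linarith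
    qed
    with y z show "0 < p$j + t * b \<and> 0 < p$k + t * c \<and>
      (p$j + t * b) * (p$k + t * c) < (2 * A)\<^sup>2" by blast
  qed
  note line = conway_line_C1[OF dist, of "{0..1}" "p$j" b "p$k" c A, OF pos, folded f_def f'_def,
      folded \<gamma>_def \<gamma>'_def]
  have ends: "\<gamma> 0 = conway_edges p" "\<gamma> 1 = conway_edges q"
    using conway_graph_self[OF dist p] conway_graph_self[OF dist q]
    by (simp_all add: \<gamma>_def f_def b_def c_def)
  have \<gamma>pos: "0 < \<gamma> t $ l" if "t \<in> {0..1}" for t l
    unfolding \<gamma>_def using conway_edges_pos line(3)[OF that] by blast
  have der: "(\<gamma> has_vector_derivative \<gamma>' t) (at t within {0..1})" if "t \<in> {0..1}" for t
    using line(1)[OF that] by (rule has_vector_derivative_at_within)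
  have "C1_curve 0 1 \<gamma>" unfolding C1_curve_def using line(2) der by blast
  then have C1: "piecewise_C1_curve 0 1 \<gamma>"
    unfolding piecewise_C1_curve_def by (intro exI[of _ 1] exI[of _ real]) auto
  have between: "\<gamma> \<in> curves_between (acute_triangles A) (conway_edges p) (conway_edges q)"
    unfolding curves_between_def acute_triangles_eq_image[OF A]
    using C1 ends line(3) by (auto simp: \<gamma>_def)
  \<comment> \<open>The sign of the logarithmic derivative of the \<open>i\<close>th edge. If
    \<open>b + c = 0\<close>, then \<open>b = c = 0\<close> and the curve is constant.\<close>
  define s where "s = sgn (b + c)"
  have bound: "F_edge (\<gamma> t) (vector_derivative \<gamma> (at t within {0..1})) \<le> s * (\<gamma>' t $ i / \<gamma> t $ i)"
    if "t \<in> {0..1}" for t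
  proof -
    have ft: "f t $ j = p$j + t * b" "f t $ k = p$k + t * c" "f' t $ j = b" "f' t $ k = c"
      using dist by (simp_all add: f_def f'_def conway_graph_def conway_graph_deriv_def)
    have "vector_derivative \<gamma> (at t within {0..1}) = \<gamma>' t"
      using vector_derivative_within_closed_interval[OF _ that der[OF that]] by simp
    moreover have "F_edge (\<gamma> t) (\<gamma>' t) \<le> \<bar>f' t $ j + f' t $ k\<bar> / (2 * (f t $ j + f t $ k))"
      unfolding \<gamma>_def \<gamma>'_def
    proof (rule F_edge_conway_deriv[OF dist line(3)[OF that]])
      show "f' t $ i * (f t $ j + f t $ k) + f' t $ j * (f t $ i + f t $ k) + f' t $ k * (f t $ i + f t $ j) = 0"
        using conway_graph_deriv_solves[OF dist, of "p$j + t * b" "p$k + t * c" A b c] bspec[OF pos that]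
        unfolding ft unfolding f_def f'_def by simp
      show "0 \<le> f' t $ j * f' t $ k" unfolding ft using mono by (simp add: b_def c_def)
    qed
    moreover have "\<gamma>' t $ i / \<gamma> t $ i = (b + c) / (2 * (f t $ j + f t $ k))"
    proof -
      have "\<gamma> t $ i = sqrt (f t $ j + f t $ k)"
        "\<gamma>' t $ i = (b + c) / (2 * sqrt (f t $ j + f t $ k))"
        by (simp_all add: \<gamma>_def \<gamma>'_def conway_edges_deriv_def conway_edges_def
            sum_distinct3[OF dist] ft(3,4))
      moreover have "0 < f t $ j + f t $ k" using bspec[OF pos that] by (simp add: ft)
      ultimately show ?thesis by (simp add: mult.assoc)
    qed
    ultimately show ?thesis by (simp add: ft s_def abs_sgn mult.commute)
  qed
  have "((\<lambda>t. \<gamma>' t $ i / \<gamma> t $ i) has_integral ln (\<gamma> 1 $ i) - ln (\<gamma> 0 $ i)) {0..1}"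
    by (rule has_integral_log_derivative) (use der \<gamma>pos in auto)
  then have int: "((\<lambda>t. s * (\<gamma>' t $ i / \<gamma> t $ i)) has_integral s * (ln (\<gamma> 1 $ i) - ln (\<gamma> 0 $ i))) {0..1}"
    by (rule has_integral_mult_right)
  have "finsler_length F_edge 0 1 \<gamma> \<le> integral {0..1} (\<lambda>t. s * (\<gamma>' t $ i / \<gamma> t $ i))"
    unfolding finsler_length_def
    using piecewise_C1_curve_F_edge_length[OF C1 \<gamma>pos] has_integral_integrable[OF int] bound
    by (intro integral_le) blast+
  also have "\<dots> = s * (ln (\<gamma> 1 $ i) - ln (\<gamma> 0 $ i))" using int by (rule integral_unique)
  also have "\<dots> \<le> \<bar>s * (ln (\<gamma> 1 $ i) - ln (\<gamma> 0 $ i))\<bar>" by (rule abs_ge_self)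
  also have "\<dots> \<le> \<bar>ln (\<gamma> 1 $ i) - ln (\<gamma> 0 $ i)\<bar>"
    by (simp add: abs_mult s_def mult_left_le_one_le abs_sgn_eq)
  finally show ?thesis
    using between unfolding ends by (subst abs_minus_commute) blast
qed

section \<open>Equality of the metric and the infimum of lengths\<close>

lemma exists_curve_length_le_m_dist:
  assumes A: "A > 0" and x: "x \<in> acute_triangles A" and y: "y \<in> acute_triangles A"
  shows "\<exists>c\<in>curves_between (acute_triangles A) x y. finsler_length F_edge 0 1 c \<le> m_dist x y"
proof -
  obtain p q where p: "p \<in> conway_set A" "x = conway_edges p"
    and q: "q \<in> conway_set A" "y = conway_edges q"
    using x y by (auto simp: acute_triangles_eq_image[OF A])
  \<comment> \<open>Three real numbers cannot have pairwise strictly opposite signs.\<close>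
  have "0 \<le> (q$2 - p$2) * (q$3 - p$3) \<or> 0 \<le> (q$3 - p$3) * (q$1 - p$1) \<or> 0 \<le> (q$1 - p$1) * (q$2 - p$2)"
    unfolding zero_le_mult_iff by linarith
  then obtain i j k :: 3 where "i \<noteq> j" "j \<noteq> k" "i \<noteq> k" "0 \<le> (q$j - p$j) * (q$k - p$k)"
  proof (elim disjE)
    assume ijk: "\<And>i j k :: 3. i \<noteq> j \<Longrightarrow> j \<noteq> k \<Longrightarrow> i \<noteq> k \<Longrightarrow> 0 \<le> (q$j - p$j) * (q$k - p$k) \<Longrightarrow> thesis"
    show thesis if "0 \<le> (q$2 - p$2) * (q$3 - p$3)" by (rule ijk[of 1 2 3]) (use that in auto)
    show thesis if "0 \<le> (q$3 - p$3) * (q$1 - p$1)" by (rule ijk[of 2 3 1]) (use that in auto)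
    show thesis if "0 \<le> (q$1 - p$1) * (q$2 - p$2)" by (rule ijk[of 3 1 2]) (use that in auto)
  qed
  from conway_line_length[OF A this(1-3) p(1) q(1) this(4)] obtain c
    where c: "c \<in> curves_between (acute_triangles A) x y"
      and "finsler_length F_edge 0 1 c \<le> \<bar>ln (x$i) - ln (y$i)\<bar>"
    unfolding p q by blast
  moreover have "\<bar>ln (x$i) - ln (y$i)\<bar> \<le> m_dist x y"
    using m_dist_le_iff[of x y "m_dist x y"] acute_triangles_pos[OF A] x y by blast
  ultimately show ?thesis by force
qed

text \<open>The length bounds the change of every \<open>ln (c t $ i)\<close>, and
  \<open>m_dist\<close> is the largest of these changes between the ends.\<close>

lemma m_dist_le_finsler_length:
  assumes A: "A > 0" and c: "c \<in> curves_between (acute_triangles A) x y"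
  shows "m_dist x y \<le> finsler_length F_edge 0 1 c"
proof -
  have C1: "piecewise_C1_curve 0 1 c" and sub: "c ` {0..1} \<subseteq> acute_triangles A"
    and ends: "c 0 = x" "c 1 = y"
    using c unfolding curves_between_def by auto
  have pos: "0 < c t $ i" if "t \<in> {0..1}" for t i
    using acute_triangles_pos[OF A] sub that by blast
  have "0 < x$i" "0 < y$i" for i using pos[of 0 i] pos[of 1 i] ends by auto
  then show ?thesis
    using piecewise_C1_curve_F_edge_length[OF C1 pos] ends
    by (simp add: m_dist_le_iff abs_minus_commute)
qed

theorem theorem6:
  fixes A :: real
  assumes "A > 0"
  shows "finsler_metric (acute_triangles A) m_dist \<and>
         length_metric_of (acute_triangles A) F_edge m_dist"
proof -
  have "ereal (m_dist x y) =
      (INF c\<in>curves_between (acute_triangles A) x y. ereal (finsler_length F_edge 0 1 c))"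
    if xy: "x \<in> acute_triangles A" "y \<in> acute_triangles A" for x y
  proof (rule order.antisym)
    show "ereal (m_dist x y) \<le>
        (INF c\<in>curves_between (acute_triangles A) x y. ereal (finsler_length F_edge 0 1 c))"
      by (rule INF_greatest) (simp add: m_dist_le_finsler_length[OF assms])
    \<comment> \<open>This curve attains the infimum.\<close>
    obtain c where "c \<in> curves_between (acute_triangles A) x y"
      "finsler_length F_edge 0 1 c \<le> m_dist x y"
      using exists_curve_length_le_m_dist[OF assms xy] by blast
    then show "(INF c\<in>curves_between (acute_triangles A) x y. ereal (finsler_length F_edge 0 1 c))
        \<le> ereal (m_dist x y)"
      by (intro INF_lower2) auto
  qed
  then have "length_metric_of (acute_triangles A) F_edge m_dist"
    unfolding length_metric_of_def
    using metric_on_m_dist acute_triangles_pos[OF assms] finsler_structure_F_edge[OF assms] by blast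
  then show ?thesis unfolding finsler_metric_def by blast
qed

end
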